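(* Let $p$ be a prime number, let $k\ge 2$ be an integer, let $n>m\ge 1$ be integers, and let $\epsilon_1,\epsilon_2\in\{-1,+1\}$. Then $f(x)=x^n+\epsilon_1x^m+\epsilon_2 p^k$ is a product of at most $k$ pairwise distinct non-reciprocal irreducible polynomials over $\mathbb{Q}$.
   Context: A polynomial $g(x)$ of degree $s$ with $g(0)\neq 0$ is called reciprocal if $x^s g(1/x)=\pm g(x)$, and non-reciprocal otherwise. *)

theory Defs
  imports "HOL-Computational_Algebra.Computational_Algebra"
begin

text \<open>
  If \<open>g\<close> has nonzero constant coefficient, then \<open>reflect_poly g\<close> is the polynomial
  \<open>x ^ s * g (1 / x)\<close> with \<open>s = degree g\<close>; see the lemma below. Both notions apply only to
  polynomials \<open>g\<close> with \<open>g(0) \<noteq> 0\<close>.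
\<close>

definition reciprocal_poly :: "'a::comm_ring_1 poly \<Rightarrow> bool" where
  "reciprocal_poly g \<longleftrightarrow> poly g 0 \<noteq> 0 \<and> (reflect_poly g = g \<or> reflect_poly g = - g)"

definition non_reciprocal_poly :: "'a::comm_ring_1 poly \<Rightarrow> bool" where
  "non_reciprocal_poly g \<longleftrightarrow> poly g 0 \<noteq> 0 \<and> \<not> reciprocal_poly g"

lemma reciprocal_poly_iff_eval:
  fixes g :: "'a::field_char_0 poly"
  shows "reciprocal_poly g \<longleftrightarrow> poly g 0 \<noteq> 0 \<and>
    ((\<forall>x. x \<noteq> 0 \<longrightarrow> x ^ degree g * poly g (1 / x) = poly g x) \<or>
     (\<forall>x. x \<noteq> 0 \<longrightarrow> x ^ degree g * poly g (1 / x) = - poly g x))"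
proof -
  have eq: "reflect_poly g = h \<longleftrightarrow> (\<forall>x. x \<noteq> 0 \<longrightarrow> x ^ degree g * poly g (1 / x) = poly h x)"
    (is "_ \<longleftrightarrow> ?R") for h
  proof
    assume "reflect_poly g = h"
    then show ?R
      by (auto simp: poly_reflect_poly_nz inverse_eq_divide)
  next
    assume R: ?R
    have "poly (reflect_poly g - h) x = 0" if "x \<noteq> 0" for x
      using R that by (simp add: poly_reflect_poly_nz inverse_eq_divide)
    then have "UNIV - {0} \<subseteq> {x. poly (reflect_poly g - h) x = 0}"
      by auto
    moreover have "infinite (UNIV - {0} :: 'a set)"
      by (simp add: infinite_UNIV_char_0)
    ultimately have "reflect_poly g - h = 0"
      using poly_roots_finite finite_subset by blast
    then show "reflect_poly g = h"
      by simp
  qed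
  show ?thesis
    by (simp add: reciprocal_poly_def eq)
qed

end

theory Submission
  imports Defs "HOL-Computational_Algebra.Field_as_Ring"
begin

text \<open>
  Every complex root of \<open>f\<close> has modulus greater than \<open>1\<close>, because \<open>|z ^ n \<plusminus> z ^ m| \<le> 2 < p ^ k\<close>
  whenever \<open>|z| \<le> 1\<close>. A multiple root would satisfy \<open>z ^ (n - m) = \<minusplus>m / n\<close> and so have modulus
  less than \<open>1\<close>; hence \<open>f\<close> is squarefree. By Gauss' lemma its monic irreducible factors \<open>g\<close> have
  integer coefficients, and \<open>|g 0|\<close>, the product of the moduli of the roots of \<open>g\<close>, exceeds \<open>1\<close>.
  A monic reciprocal polynomial has \<open>|g 0| = 1\<close>, so no \<open>g\<close> is reciprocal. Finally every \<open>g 0\<close> is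
  divisible by \<open>p\<close> and the product of all of them is \<open>\<plusminus>p ^ k\<close>, so there are at most \<open>k\<close> factors.
\<close>

lemma map_poly_of_int_mult:
  "map_poly of_int (p * q) = (map_poly of_int p * map_poly of_int q :: 'a::comm_ring_1 poly)"
  by (intro poly_eqI) (simp add: coeff_map_poly coeff_mult)

lemma map_poly_of_rat_mult:
  "map_poly of_rat (p * q) = (map_poly of_rat p * map_poly of_rat q :: 'a::field_char_0 poly)"
  by (intro poly_eqI) (simp add: coeff_map_poly coeff_mult of_rat_sum of_rat_mult)

lemma norm_of_rat: "norm (of_rat r :: 'a::real_normed_field) = of_rat \<bar>r\<bar>"
proof -
  obtain a b where "r = of_int a / of_int b"
    by (metis quotient_of_div surj_pair)
  then show ?thesis
    by (simp add: of_rat_divide norm_divide flip: of_int_abs)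
qed

lemma clear_denominators_poly:
  fixes g :: "rat poly"
  shows "\<exists>d G. d > 0 \<and> smult (of_int d) g = map_poly of_int G"
proof (induction g)
  case 0
  show ?case by (intro exI[of _ 1] exI[of _ 0]) simp
next
  case (pCons a g)
  then obtain d G where d: "d > 0" "smult (of_int d) g = map_poly of_int G"
    by blast
  obtain u v where "quotient_of a = (u, v)"
    by fastforce
  then have v: "v > 0" and a: "a = of_int u / of_int v"
    by (auto dest: quotient_of_denom_pos quotient_of_div)
  have "smult (of_int v) (smult (of_int d) g) = smult (of_int v) (map_poly of_int G)"
    using d by simp
  then have "smult (of_int (d * v)) g = map_poly of_int (smult v G)"
    by (simp add: map_poly_smult mult.commute)
  then have "smult (of_int (d * v)) (pCons a g) = map_poly of_int (pCons (u * d) (smult v G))"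
    using v by (simp add: a map_poly_pCons)
  with d v show ?case
    by (metis mult_pos_pos)
qed

text \<open>Gauss' lemma by contents: after clearing denominators, monicity bounds the content of
  each factor by its denominator, and multiplicativity of \<open>content\<close> forces equality, so
  the denominator divides out again.\<close>

lemma monic_factor_integral:
  fixes g h :: "rat poly"
  assumes gh: "g * h = map_poly of_int F" and "lead_coeff g = 1" and "lead_coeff h = 1"
  shows "\<exists>G. g = map_poly of_int G"
proof -
  obtain d G where d: "d > 0" and G: "smult (of_int d) g = map_poly of_int G"
    using clear_denominators_poly by blast
  obtain e H where e: "e > 0" and H: "smult (of_int e) h = map_poly of_int H"
    using clear_denominators_poly by blast
  have cG: "of_int (coeff G i) = of_int d * coeff g i" for i
    using arg_cong[OF G, of "\<lambda>p. coeff p i"] by (simp add: coeff_map_poly)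
  have cH: "of_int (coeff H i) = of_int e * coeff h i" for i
    using arg_cong[OF H, of "\<lambda>p. coeff p i"] by (simp add: coeff_map_poly)
  have cF: "of_int (coeff F i) = coeff (g * h) i" for i
    by (simp add: gh coeff_map_poly)
  \<comment> \<open>Since \<open>g\<close> is monic, the denominator \<open>d\<close> itself occurs
    as a coefficient of \<open>G\<close>.\<close>
  have "rat_of_int (coeff G (degree g)) = of_int d"
    using assms cG by simp
  then have "content G dvd d"
    by (metis content_dvd_coeff of_int_eq_iff)
  have "rat_of_int (coeff H (degree h)) = of_int e"
    using assms cH by simp
  then have "content H dvd e"
    by (metis content_dvd_coeff of_int_eq_iff)
  have "rat_of_int (coeff F (degree g + degree h)) = 1"
    using assms(2,3) by (simp add: cF coeff_mult_degree_sum)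
  then have "content F dvd 1"
    by (metis content_dvd_coeff of_int_eq_1_iff)
  then have "content F = 1"
    by (rule iffD1[OF is_unit_content_iff])
  have "map_poly rat_of_int (G * H) = map_poly of_int (smult (d * e) F)"
    by (simp add: map_poly_of_int_mult map_poly_smult mult.commute flip: G H gh)
  then have "rat_of_int (coeff (G * H) i) = of_int (coeff (smult (d * e) F) i)" for i
    by (metis coeff_map_poly of_int_0)
  then have "G * H = smult (d * e) F"
    by (intro poly_eqI) (simp only: of_int_eq_iff)
  then have "content G * content H = d * e"
    using d e \<open>content F = 1\<close> by (metis content_mult content_smult abs_mult_pos
      abs_of_pos mult.right_neutral mult_pos_pos normalize_int_def)
  moreover have "content G \<le> d" "content H \<le> e"
    using d e \<open>content G dvd d\<close> \<open>content H dvd e\<close> by (auto intro: zdvd_imp_le)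
  moreover have "content G \<ge> 0" "content H \<ge> 0"
    by (metis abs_ge_zero normalize_content normalize_int_def)+
  \<comment> \<open>Two nonnegative factors bounded by \<open>d\<close> and \<open>e\<close> can
    have product \<open>d * e > 0\<close> only if both bounds are attained.\<close>
  ultimately have "content G = d"
    using d e by (smt (verit) mult_less_le_imp_less zero_less_mult_iff)
  then have "rat_of_int (coeff G i) = of_int d * of_int (coeff G i div d)" for i
    by (metis content_dvd_coeff dvd_mult_div_cancel of_int_mult)
  then have "coeff g i = of_int (coeff G i div d)" for i
    using d cG[of i] by simp
  then have "g = map_poly of_int (map_poly (\<lambda>c. c div d) G)"
    by (intro poly_eqI) (simp add: coeff_map_poly)
  then show ?thesis ..
qed

lemma norm_poly_0_gt_1:
  fixes g :: "complex poly"
  assumes "lead_coeff g = 1" and "degree g > 0" and roots: "\<And>z. poly g z = 0 \<Longrightarrow> norm z > 1"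
  shows "norm (poly g 0) > 1"
proof -
  obtain r where "smult (lead_coeff g) (\<Prod>i<degree g. [:- r i, 1:]) = g"
    using complex_poly_decompose' by blast
  then have g: "g = (\<Prod>i<degree g. [:- r i, 1:])"
    using assms by simp
  have "norm (r i) > 1" if "i < degree g" for i
    using that by (intro roots) (subst g, auto simp: poly_prod)
  moreover have "norm (poly g 0) = (\<Prod>i<degree g. norm (r i))"
    by (subst g) (simp add: poly_prod flip: prod_norm)
  \<comment> \<open>Positive degree makes the product of moduli nonempty, hence strictly greater
    than 1.\<close>
  ultimately show ?thesis
    using \<open>degree g > 0\<close> by (auto intro!: less_1_prod simp: lessThan_empty_iff)
qed

text \<open>Reflection moves the leading coefficient 1 to the constant term, where it cannot equal
  plus or minus \<open>poly g 0\<close>.\<close>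

lemma non_reciprocal_polyI:
  fixes g :: "'a::linordered_idom poly"
  assumes "lead_coeff g = 1" and "\<bar>poly g 0\<bar> > 1"
  shows "non_reciprocal_poly g"
proof -
  have "coeff (reflect_poly g) 0 \<noteq> coeff g 0" "coeff (reflect_poly g) 0 \<noteq> coeff (- g) 0"
    using assms by (auto simp: poly_0_coeff_0)
  then have "reflect_poly g \<noteq> g" "reflect_poly g \<noteq> - g"
    by metis+
  then show ?thesis
    using assms by (auto simp: non_reciprocal_poly_def reciprocal_poly_def)
qed

lemma trinomial_root_norm_gt_1:
  fixes z :: complex and e1 e2 :: rat
  assumes "e1 \<in> {-1, 1}" and "e2 \<in> {-1, 1}" and "q > 2"
    and root: "z ^ n + of_rat e1 * z ^ m + of_rat e2 * of_nat q = 0"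
  shows "norm z > 1"
proof (rule ccontr)
  assume "\<not> norm z > 1"
  then have "norm z ^ n \<le> 1" "norm z ^ m \<le> 1"
    by (simp_all add: power_le_one)
  have "norm (of_rat e2 * of_nat q :: complex) = of_nat q"
    using assms by (auto simp: norm_mult of_rat_minus)
  moreover have "of_rat e2 * of_nat q = - (z ^ n + of_rat e1 * z ^ m)"
    using root by (simp add: add_eq_0_iff)
  ultimately have "of_nat q = norm (z ^ n + of_rat e1 * z ^ m)"
    by (metis norm_minus_cancel)
  also have "\<dots> \<le> norm z ^ n + norm z ^ m"
    using assms by (intro norm_triangle_le) (auto simp: norm_mult norm_power of_rat_minus)
  also have "\<dots> \<le> 2"
    using \<open>norm z ^ n \<le> 1\<close> \<open>norm z ^ m \<le> 1\<close> by simp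
  finally show False
    using \<open>q > 2\<close> by simp
qed

text \<open>The moduli of the two terms are compared directly, without dividing by a power of
  \<open>z\<close>, so \<open>z = 0\<close> needs no separate case.\<close>

lemma trinomial_derivative_root_norm_less_1:
  fixes z :: complex and e :: rat
  assumes "e \<in> {-1, 1}" and "n > m" and "m \<ge> 1"
    and root: "of_nat n * z ^ (n - 1) + of_rat e * of_nat m * z ^ (m - 1) = 0"
  shows "norm z < 1"
proof (rule ccontr)
  assume "\<not> norm z < 1"
  then have z: "norm z \<ge> 1" by simp
  have "of_nat n * z ^ (n - 1) = - (of_rat e * of_nat m * z ^ (m - 1))"
    using root by (simp add: add_eq_0_iff2)
  then have "norm (of_nat n * z ^ (n - 1)) = norm (of_rat e * of_nat m * z ^ (m - 1))"
    by (metis norm_minus_cancel)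
  then have "of_nat n * norm z ^ (n - 1) = of_nat m * norm z ^ (m - 1)"
    using assms by (auto simp: norm_mult norm_power of_rat_minus)
  also have "\<dots> \<le> of_nat m * norm z ^ (n - 1)"
    using assms z by (intro mult_left_mono power_increasing) auto
  also have "\<dots> < of_nat n * norm z ^ (n - 1)"
    using z \<open>n > m\<close> by (intro mult_strict_right_mono zero_less_power) auto
  finally show False by simp
qed

text \<open>Each \<open>c x\<close> is a divisor of \<open>p ^ k\<close> greater than 1, so it
  contributes at least one factor \<open>p\<close>.\<close>

lemma card_le_if_prod_eq_prime_power:
  fixes c :: "'a \<Rightarrow> nat"
  assumes "prime p" and "finite S" and "(\<Prod>x\<in>S. c x) = p ^ k" and "\<And>x. x \<in> S \<Longrightarrow> c x > 1"
  shows "card S \<le> k"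
proof -
  have "p dvd c x" if "x \<in> S" for x
  proof -
    have "c x dvd p ^ k"
      using assms(2,3) that by (metis dvd_prodI)
    then obtain i where "c x = p ^ i"
      using \<open>prime p\<close> by (auto simp: divides_primepow_nat)
    then show ?thesis
      using assms(4)[OF that] by (cases i) auto
  qed
  then have "(\<Prod>x\<in>S. p) dvd (\<Prod>x\<in>S. c x)"
    by (intro prod_dvd_prod)
  then have "p ^ card S dvd p ^ k"
    using assms by simp
  then show ?thesis
    using \<open>prime p\<close> by (simp add: dvd_power_iff_le prime_ge_2_nat)
qed

lemma square_dvd_imp_dvd_pderiv:
  fixes g f :: "'a::idom poly"
  assumes "g ^ 2 dvd f"
  shows "g dvd pderiv f"
proof -
  obtain h where "f = g * (g * h)"
    using assms by (metis dvdE mult.assoc power2_eq_square)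
  then show ?thesis
    by (simp add: pderiv_mult)
qed

text \<open>The predicate \<open>prime\<close> includes being normalized, which over a field means
  being monic.\<close>

lemma monic_if_prime_rat_poly:
  fixes g :: "rat poly"
  assumes "prime g"
  shows "lead_coeff g = 1"
proof -
  have "unit_factor g = 1"
    using assms by (metis not_prime_0 normalize_prime unit_factor_normalize)
  then show ?thesis
    by (simp add: unit_factor_poly_def one_pCons)
qed

theorem theorem3:
  fixes p k n m :: nat and \<epsilon>\<^sub>1 \<epsilon>\<^sub>2 :: rat and f :: "rat poly"
  assumes "prime p" and "k \<ge> 2" and "n > m" and "m \<ge> 1"
    and "\<epsilon>\<^sub>1 \<in> {-1, 1}" and "\<epsilon>\<^sub>2 \<in> {-1, 1}"
    and "f = monom 1 n + monom \<epsilon>\<^sub>1 m + [:\<epsilon>\<^sub>2 * of_nat p ^ k:]"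
  shows "\<exists>S :: rat poly set. finite S \<and> card S \<le> k \<and>
    (\<forall>g\<in>S. lead_coeff g = 1 \<and> irreducible g \<and> non_reciprocal_poly g) \<and>
    f = \<Prod>S"
proof -
  note f = assms(7)
  \<comment> \<open>Here \<open>k \<ge> 2\<close> enters: for \<open>p = 2\<close> and
    \<open>k = 1\<close> the strict bound \<open>p ^ k > 2\<close> would fail.\<close>
  have "(2::nat) ^ 2 \<le> p ^ k"
    using assms(1-6) by (meson le_trans power_increasing power_mono prime_ge_1_nat prime_ge_2_nat zero_le)
  then have q: "p ^ k > 2" by simp
  have cf: "coeff f i = (if i = n then 1 else if i = m then \<epsilon>\<^sub>1 else if i = 0 then \<epsilon>\<^sub>2 * of_nat p ^ k else 0)"
    for i using assms(1-6) by (auto simp: f coeff_pCons split: nat.splits)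
  have deg: "degree f = n"
    by (intro antisym degree_le le_degree) (use assms(1-6) in \<open>auto simp: cf\<close>)
  have monic: "lead_coeff f = 1" by (simp add: deg cf)
  then have "f \<noteq> 0" by auto

  have root: "norm z > 1"
    if "poly (map_poly of_rat g) z = 0" and dvd: "g dvd f" for g and z :: complex
  proof -
    obtain h where "f = g * h" using dvd by (elim dvdE)
    then have "poly (map_poly of_rat f) z = 0"
      using that by (simp add: map_poly_of_rat_mult)
    moreover have "map_poly of_rat f = monom 1 n + monom (of_rat \<epsilon>\<^sub>1) m + [:of_rat \<epsilon>\<^sub>2 * of_nat (p ^ k) :: complex:]"
      using assms(1-6) by (intro poly_eqI)
        (auto simp: cf coeff_map_poly coeff_pCons of_rat_mult of_rat_power of_rat_minus split: nat.splits)
    ultimately have "z ^ n + of_rat \<epsilon>\<^sub>1 * z ^ m + of_rat \<epsilon>\<^sub>2 * of_nat (p ^ k) = 0"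
      by (simp add: poly_monom)
    then show ?thesis
      using trinomial_root_norm_gt_1 assms q by blast
  qed

  have crit: "norm z < 1"
    if "poly (map_poly of_rat g) z = 0" and dvd: "g dvd pderiv f" for g and z :: complex
  proof -
    obtain h where "pderiv f = g * h" using dvd by (elim dvdE)
    then have "poly (map_poly of_rat (pderiv f)) z = 0"
      using that by (simp add: map_poly_of_rat_mult)
    moreover have "map_poly of_rat (pderiv f) =
        monom (of_nat n) (n - 1) + monom (of_rat \<epsilon>\<^sub>1 * of_nat m :: complex) (m - 1)"
      using assms(1-6) by (intro poly_eqI)
        (auto simp: f pderiv_add pderiv_monom pderiv_pCons coeff_map_poly of_rat_mult of_rat_add of_rat_minus)
    ultimately show ?thesis
      using assms(1-6) by (intro trinomial_derivative_root_norm_less_1[of \<epsilon>\<^sub>1 m n]) (auto simp: poly_monom)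
  qed

  \<comment> \<open>As a set, \<open>prime_factors f\<close> forgets multiplicities;
    \<open>mult\<close> below shows that they are all 1, so that \<open>\<Prod>S\<close> recovers
    \<open>f\<close>.\<close>
  define S where "S = prime_factors f"
  have S: "prime g" "g dvd f" "lead_coeff g = 1" "degree g > 0" if "g \<in> S" for g
  proof -
    show "prime g" "g dvd f"
      using that by (auto simp: S_def)
    then show "lead_coeff g = 1"
      by (intro monic_if_prime_rat_poly)
    \<comment> \<open>A monic constant is 1, which is not prime.\<close>
    show "degree g > 0"
      using \<open>prime g\<close> \<open>lead_coeff g = 1\<close>
      by (metis degree_eq_zeroE gr0I lead_coeff_pCons(2) not_prime_1 one_pCons)
  qed
  have gt_1: "\<bar>poly g 0\<bar> > 1" if "g \<in> S" for g
  proof -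
    \<comment> \<open>The roots of \<open>g\<close> are roots of \<open>f\<close>, so the bound is
      obtained over the complex numbers and pulled back by \<open>norm_of_rat\<close>.\<close>
    have "norm (poly (map_poly of_rat g :: complex poly) 0) > 1"
      using S[OF that] root[of g]
      by (intro norm_poly_0_gt_1) (auto simp: coeff_map_poly degree_map_poly)
    then show ?thesis
      by (simp add: poly_0_coeff_0 coeff_map_poly norm_of_rat)
  qed
  have mult: "multiplicity g f = 1" if "g \<in> S" for g
  proof -
    have "\<not> g ^ 2 dvd f"
    proof
      assume "g ^ 2 dvd f"
      then have "g dvd pderiv f" by (rule square_dvd_imp_dvd_pderiv)
      \<comment> \<open>A complex root of \<open>g\<close> would be common to \<open>f\<close> and
        its derivative, so its modulus would be both above and below 1.\<close>
      moreover have "\<not> constant (poly (map_poly of_rat g :: complex poly))"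
        using S[OF that] by (simp add: constant_degree degree_map_poly)
      then obtain z :: complex where "poly (map_poly of_rat g) z = 0"
        using fundamental_theorem_of_algebra by blast
      ultimately show False
        using crit root S[OF that] by (meson less_asym)
    qed
    then show ?thesis
      using S[OF that] \<open>f \<noteq> 0\<close> by (intro multiplicity_eqI) (auto simp: numeral_2_eq_2)
  qed
  have "normalize f = f"
    using monic by (simp add: normalize_poly_def flip: one_pCons)
  then have prod: "f = \<Prod>S"
    using prod_prime_factors[OF \<open>f \<noteq> 0\<close>] mult by (simp add: S_def)

  have int: "poly g 0 \<in> \<int>" if g: "g \<in> S" for g
  proof -
    obtain h where h: "f = g * h" using S(2)[OF g] by (elim dvdE)
    \<comment> \<open>All coefficients of \<open>f\<close> are integers, so \<open>floor\<close>
      merely changes their type.\<close>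
    have "f = map_poly of_int (map_poly floor f)"
      using assms(1-6) by (intro poly_eqI) (auto simp: coeff_map_poly cf simp flip: of_nat_power)
    moreover have "lead_coeff h = 1"
      using monic S[OF g] by (simp add: h lead_coeff_mult)
    ultimately obtain G where "g = map_poly of_int G"
      using monic_factor_integral h S[OF g] by metis
    then show ?thesis
      by (simp add: poly_0_coeff_0 coeff_map_poly)
  qed
  \<comment> \<open>By \<open>int\<close>, no rounding happens on \<open>S\<close>; the conversion
    to \<open>nat\<close> allows the divisibility count for prime powers.\<close>
  define c where "c g = nat \<lfloor>\<bar>poly g 0\<bar>\<rfloor>" for g :: "rat poly"
  have c: "of_nat (c g) = \<bar>poly g 0\<bar>" if "g \<in> S" for g
    using int[OF that] by (auto simp: c_def elim!: Ints_cases)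
  \<comment> \<open>This is the factorization \<open>f = \<Prod>S\<close> evaluated at 0.\<close>
  have "rat_of_nat (\<Prod>g\<in>S. c g) = \<bar>poly f 0\<bar>"
    by (simp add: c prod poly_prod abs_prod)
  also have "\<dots> = rat_of_nat (p ^ k)"
    using assms(1-6) by (auto simp: poly_0_coeff_0 cf abs_mult)
  finally have "(\<Prod>g\<in>S. c g) = p ^ k"
    by (simp only: of_nat_eq_iff)
  moreover have "c g > 1" if "g \<in> S" for g
    using gt_1[OF that] unfolding c[OF that, symmetric] by simp
  ultimately have "card S \<le> k"
    using \<open>prime p\<close> by (intro card_le_if_prod_eq_prime_power[of p S c]) (auto simp: S_def)
  moreover have "irreducible g \<and> non_reciprocal_poly g" if "g \<in> S" for g
    using S[OF that] gt_1[OF that]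
    by (auto intro: non_reciprocal_polyI prime_elem_imp_irreducible)
  moreover have "finite S" by (simp add: S_def)
  ultimately show ?thesis
    using S prod by blast
qed

end
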